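(* For each $n\ge 4$ let $d_n$ be the number of permutations $\pi\in S_n^1(1\text{-}2\text{-}3)$ for which $(1\text{-}23)\pi=0$, i.e. the permutations of length $n$ that contain exactly one occurrence of the pattern $(1\text{-}2\text{-}3)$ and no occurrence of the pattern $(1\text{-}23)$. Then, as formal power series, $$\sum_{n\ge 4} d_n x^n = x^4 C(x)^7=\sum_{n\ge 4}\frac{7}{n+3}\binom{2n-2}{n+2}x^n.$$
   Context: Let $\pi=\pi_1\pi_2\cdots\pi_n$ be a permutation of $\{1,\ldots,n\}$. An occurrence of the pattern $(1\text{-}2\text{-}3)$ in $\pi$ is a triple of positions $i<j<m$ with $\pi_i<\pi_j<\pi_m$. An occurrence of the pattern $(1\text{-}23)$ in $\pi$ is such a triple in which the last two positions are adjacent, i.e. $m=j+1$. For a pattern $q$, $(q)\pi$ denotes the number of occurrences of $q$ in $\pi$, and $S_n^k(q)$ denotes the set of permutations of length $n$ containing exactly $k$ occurrences of $q$. $C(x)=\frac{1-\sqrt{1-4x}}{2x}=\sum_{n\ge 0}\frac{1}{n+1}\binom{2n}{n}x^n$ is the Catalan generating function. *)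

theory Defs
  imports
    Complex_Main
    "HOL-Combinatorics.Permutations"
    "HOL-Computational_Algebra.Computational_Algebra"
begin

(* A permutation of {1..n} is a function \<pi> with \<pi> permutes {1..n}; its i-th letter is \<pi> i.
   An occurrence of a pattern is the triple of positions where it is found. *)

definition occs_1_2_3 :: "nat \<Rightarrow> (nat \<Rightarrow> nat) \<Rightarrow> (nat \<times> nat \<times> nat) set" where
  "occs_1_2_3 n \<pi> =
     {(i, j, m). 1 \<le> i \<and> i < j \<and> j < m \<and> m \<le> n \<and> \<pi> i < \<pi> j \<and> \<pi> j < \<pi> m}"

definition occs_1_23 :: "nat \<Rightarrow> (nat \<Rightarrow> nat) \<Rightarrow> (nat \<times> nat \<times> nat) set" where
  "occs_1_23 n \<pi> = {(i, j, m). (i, j, m) \<in> occs_1_2_3 n \<pi> \<and> m = j + 1}"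

definition perms_with_occs ::
  "(nat \<Rightarrow> (nat \<Rightarrow> nat) \<Rightarrow> (nat \<times> nat \<times> nat) set) \<Rightarrow> nat \<Rightarrow> nat \<Rightarrow> (nat \<Rightarrow> nat) set" where
  "perms_with_occs q k n = {\<pi>. \<pi> permutes {1..n} \<and> card (q n \<pi>) = k}"

definition d_seq :: "nat \<Rightarrow> nat" where
  "d_seq n = card {\<pi> \<in> perms_with_occs occs_1_2_3 1 n. card (occs_1_23 n \<pi>) = 0}"

(* The numerator has zero constant term, so division by 2x is exact division of power series;
   the square root is the one with constant term root 2 1 = 1. *)

definition catalan_gf :: "real fps" where
  "catalan_gf = (1 - fps_radical root 2 (1 - fps_const 4 * fps_X)) / (fps_const 2 * fps_X)"

lemma half_gbinomial_Suc:
  "((1/2::real) gchoose Suc n) * (-4) ^ Suc n = - 2 * (real ((2 * n) choose n) / (real n + 1))"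
proof (induction n)
  case 0
  show ?case by simp
next
  case (Suc n)
  have 1: "((1/2::real) gchoose Suc (Suc n)) =
      ((1/2) gchoose Suc n) * (1/2 - real (Suc n)) / real (Suc (Suc n))"
    by (simp add: gbinomial_prod_rev field_simps)
  have "Suc n * (Suc (2 * n) choose n) = Suc (2 * n) * (2 * n choose n)"
    using Suc_times_binomial[of n "2 * n"] binomial_symmetric[of n "Suc (2 * n)"]
    by (simp add: Suc_diff_le del: binomial_Suc_Suc)
  moreover have "(2 * Suc n choose Suc n) = 2 * (Suc (2 * n) choose n)"
    using binomial_symmetric[of n "Suc (2 * n)"] by (simp add: Suc_diff_le)
  ultimately have "Suc n * (2 * Suc n choose Suc n) = 2 * (Suc (2 * n) * (2 * n choose n))"
    by (metis mult.left_commute)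
  then have "real (Suc n * (2 * Suc n choose Suc n)) = real (2 * (Suc (2 * n) * (2 * n choose n)))"
    by (rule arg_cong)
  then have 2: "real (2 * Suc n choose Suc n) =
      2 * (2 * real n + 1) * real (2 * n choose n) / (real n + 1)"
    unfolding of_nat_mult by (simp add: divide_simps mult_ac add_ac)
  have "((1/2::real) gchoose Suc (Suc n)) * (-4) ^ Suc (Suc n) =
      (((1/2) gchoose Suc n) * (-4) ^ Suc n) * ((1/2 - real (Suc n)) * (-4) / real (Suc (Suc n)))"
    unfolding 1 power_Suc[of _ "Suc n"] by (simp only: times_divide_eq_left times_divide_eq_right ac_simps)
  also have "\<dots> = - 2 * (real (2 * n choose n) / (real n + 1)) *
      ((1/2 - real (Suc n)) * (-4) / real (Suc (Suc n)))"
    unfolding Suc.IH ..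
  also have "\<dots> = - 2 * (real (2 * Suc n choose Suc n) / (real (Suc n) + 1))"
  proof -
    have 3: "(1/2 - real (Suc n)) * (-4) = 2 * (2 * real n + 1)"
      by simp
    have 4: "real (Suc (Suc n)) = real (Suc n) + 1"
      by simp
    show ?thesis
      unfolding 2 3 4 by (simp only: divide_divide_eq_left times_divide_eq_left times_divide_eq_right ac_simps)
  qed
  finally show ?case .
qed

lemma catalan_gf_eq:
  "catalan_gf = Abs_fps (\<lambda>n. 1 / (real n + 1) * real ((2 * n) choose n))" (is "_ = ?c")
proof -
  let ?l = "fps_const (-4) * fps_X :: real fps"
  let ?s = "1 - fps_const 4 * fps_X :: real fps"
  let ?r = "fps_binomial (1/2) oo ?l"
  have "?r ^ 2 = (fps_binomial (1/2) * fps_binomial (1/2)) oo ?l"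
    by (simp add: power2_eq_square fps_compose_mult_distrib)
  also have "fps_binomial (1/2) * fps_binomial (1/2) = fps_binomial (1::real)"
    by (simp flip: fps_binomial_add_mult)
  also have "fps_binomial 1 oo ?l = ?s"
    by (simp add: fps_binomial_1 fps_compose_add_distrib flip: fps_const_neg)
  finally have "?r ^ Suc 1 = ?s" by (simp add: numeral_2_eq_2)
  then have r: "?r = fps_radical root 2 ?s"
    using radical_unique[of root 1 ?s ?r] by (simp add: numeral_2_eq_2)
  have "?r $ n = (1 - ?c * (fps_const 2 * fps_X)) $ n" for n
  proof (cases n)
    case 0
    then show ?thesis by simp
  next
    case (Suc m)
    have "?r $ n = (1/2 gchoose n) * (-4) ^ n"
      by (subst fps_compose_linear) simp
    moreover have "(?c * (fps_const 2 * fps_X)) $ Suc m = 2 * ?c $ m"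
      by (simp flip: mult.assoc)
    ultimately show ?thesis
      using half_gbinomial_Suc[of m] Suc by (simp add: mult.commute)
  qed
  then have "1 - ?r = ?c * (fps_const 2 * fps_X)"
    by (simp add: fps_eq_iff)
  then show ?thesis
    unfolding catalan_gf_def r[symmetric] by simp
qed

end

(* Permutations are grown by inserting the maximum. Putting it at position p of a word creates
   one occurrence of 1-2-3 for every non-inversion among the first p letters. So an avoider
   stays an avoider iff p lies within its initial decreasing run, and it acquires exactly one
   occurrence iff its first p letters have exactly one non-inversion; in the latter case that
   occurrence is not a 1-23 iff the first p - 1 letters already have one non-inversion.
   Counting by a lower bound r for the length of the initial decreasing run gives linear
   recurrences in (n, r). With C = 1 + x C^2 the avoiders are counted by x^r C^(r+1) (the
   Catalan tree), and the permutations in question by x^2 C^4 x^r (C^(r+1) (1 - x) - 1),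
   which is x^4 C^7 for r = 0. *)

theory Submission
  imports Defs "HOL-Combinatorics.Multiset_Permutations"
begin

section \<open>Increasing chains in a word and the effect of inserting a maximum\<close>

text \<open>Number of increasing subsequences of length \<open>k\<close> all of whose letters exceed \<open>x\<close>; since the
  letters of a permutation are positive, \<open>x = 0\<close> imposes no restriction.\<close>

fun num_chains :: "nat \<Rightarrow> nat \<Rightarrow> nat list \<Rightarrow> nat" where
  "num_chains 0 x xs = 1"
| "num_chains (Suc k) x [] = 0"
| "num_chains (Suc k) x (y # ys) = (if x < y then num_chains k y ys else 0) + num_chains (Suc k) x ys"

text \<open>The \<open>23\<close> half of a 1-23: \<open>x\<close> is a letter further left that
  plays the \<open>1\<close>.\<close>

fun ascent_above :: "nat \<Rightarrow> nat list \<Rightarrow> bool" where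
  "ascent_above x (y # z # zs) \<longleftrightarrow> x < y \<and> y < z \<or> ascent_above x (z # zs)"
| "ascent_above x _ \<longleftrightarrow> False"

fun has_1_23 :: "nat list \<Rightarrow> bool" where
  "has_1_23 [] \<longleftrightarrow> False"
| "has_1_23 (x # xs) \<longleftrightarrow> ascent_above x xs \<or> has_1_23 xs"

lemma num_chains_2_Nil [simp]: "num_chains 2 x [] = 0"
  by (simp add: numeral_2_eq_2)

lemma num_chains_eq_0:
  assumes "\<forall>y\<in>set ys. y \<le> x"
  shows "num_chains (Suc k) x ys = 0"
  using assms by (induction ys) auto

lemma num_chains_1_eq_0_iff: "num_chains (Suc 0) x ys = 0 \<longleftrightarrow> (\<forall>y\<in>set ys. y \<le> x)"
  by (induction ys) auto

lemma num_chains_1_eq_length: "0 \<notin> set ys \<Longrightarrow> num_chains (Suc 0) 0 ys = length ys"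
  by (induction ys) auto

lemma num_chains_append_ge: "num_chains k x as \<le> num_chains k x (as @ bs)"
proof (induction as arbitrary: k x)
  case Nil
  then show ?case by (cases k) auto
next
  case (Cons a as)
  then show ?case by (cases k) (auto intro: add_mono)
qed

lemma num_chains_take_mono: "p \<le> r \<Longrightarrow> num_chains k x (take p xs) \<le> num_chains k x (take r xs)"
  using num_chains_append_ge[of k x "take p xs" "take (r - p) (drop p xs)"]
  by (simp flip: take_add)

text \<open>Nothing exceeds \<open>m\<close>, so \<open>m\<close> can only be the last letter of a
  chain. Such a chain of length \<open>Suc k\<close> is a chain of length \<open>k\<close> in
  \<open>as\<close> followed by \<open>m\<close>.\<close>

lemma num_chains_insert_max:
  assumes "\<forall>y\<in>set as \<union> set bs. y < m" "x < m"
  shows "num_chains (Suc k) x (as @ m # bs) = num_chains (Suc k) x (as @ bs) + num_chains k x as"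
  using assms
proof (induction as arbitrary: k x)
  case Nil
  \<comment> \<open>For \<open>k = 0\<close> both sides are 1, otherwise both are 0.\<close>
  have "num_chains k m bs = num_chains k x []"
    using Nil num_chains_eq_0[of bs m] by (cases k) (auto simp: less_imp_le)
  with Nil show ?case by simp
next
  case (Cons y as)
  then show ?case by (cases k) auto
qed

lemma ascent_above_imp_num_chains: "ascent_above x ys \<Longrightarrow> num_chains (Suc (Suc 0)) x ys \<noteq> 0"
  by (induction x ys rule: ascent_above.induct) auto

lemma has_1_23_imp_num_chains: "has_1_23 ys \<Longrightarrow> 0 \<notin> set ys \<Longrightarrow> num_chains (Suc (Suc (Suc 0))) 0 ys \<noteq> 0"
  by (induction ys) (auto dest: ascent_above_imp_num_chains)

lemma ascent_above_max:
  assumes "\<forall>y\<in>set bs. y < m"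
  shows "ascent_above x (m # bs) \<longleftrightarrow> ascent_above x bs"
  using assms by (cases bs) auto

lemma not_ascent_above_max:
  assumes "\<forall>y\<in>set bs. y < m"
  shows "\<not> ascent_above m bs"
  using ascent_above_imp_num_chains[of m bs] num_chains_eq_0[of bs m "Suc 0"] assms by (auto simp: less_imp_le)

lemma ascent_above_insert_below:
  assumes "\<forall>y\<in>set bs. y < m" "\<forall>y\<in>set as. y \<le> x"
  shows "ascent_above x (as @ m # bs) \<longleftrightarrow> ascent_above x (as @ bs)"
  using assms(2)
proof (induction as)
  case Nil
  then show ?case by (simp add: ascent_above_max[OF assms(1)])
next
  case (Cons y as)
  have "ascent_above x (y # zs) \<longleftrightarrow> ascent_above x zs" for zs
    using Cons.prems by (cases zs) auto
  with Cons show ?case by simp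
qed

text \<open>The letters of \<open>as\<close> decrease. Both a 1-23 ending in \<open>m\<close> and
  one lost by separating \<open>as\<close> from \<open>bs\<close> would have its \<open>2\<close> at
  the end of \<open>as\<close>, and hence a smaller letter before it in \<open>as\<close>.\<close>

lemma has_1_23_insert_decreasing:
  assumes "\<forall>y\<in>set as \<union> set bs. y < m" "0 \<notin> set as" "num_chains 2 0 as = 0"
  shows "has_1_23 (as @ m # bs) \<longleftrightarrow> has_1_23 (as @ bs)"
  using assms
proof (induction as)
  case Nil
  then show ?case by (simp add: not_ascent_above_max)
next
  case (Cons x as)
  then have "\<forall>y\<in>set as. y \<le> x" "num_chains 2 0 as = 0"
    by (auto simp: numeral_2_eq_2 num_chains_1_eq_0_iff)
  with Cons show ?case
    by (simp add: ascent_above_insert_below)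
qed

lemma ascent_above_insert_max:
  assumes "\<forall>y\<in>set as \<union> set bs. y < m" "num_chains (Suc (Suc 0)) x (as @ bs) = 0"
  shows "ascent_above x (as @ m # bs) \<longleftrightarrow> as \<noteq> [] \<and> x < last as"
  using assms
proof (induction as)
  case Nil
  then show ?case
    using ascent_above_imp_num_chains[of x bs] by (auto simp: ascent_above_max)
next
  case (Cons y as)
  show ?case
  proof (cases as)
    case Nil
    with Cons show ?thesis by auto
  next
    case (Cons z zs)
    have "\<not> (x < y \<and> y < z)"
      using Cons.prems unfolding Cons by (auto split: if_splits)
    with Cons Cons.IH Cons.prems show ?thesis by auto
  qed
qed

lemma num_chains_1_butlast:
  "as \<noteq> [] \<Longrightarrow> num_chains (Suc 0) x as = num_chains (Suc 0) x (butlast as) + of_bool (x < last as)"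
  by (induction as) auto

text \<open>The old word has no 1-2-3, so a 1-23 must end in \<open>m\<close> and its
  \<open>2\<close> is the last letter of \<open>as\<close>. A smaller letter before that one exists
  iff dropping it from \<open>as\<close> loses a pair.\<close>

lemma has_1_23_insert_max:
  assumes "\<forall>y\<in>set as \<union> set bs. y < m" "0 \<notin> set as \<union> set bs"
    and "num_chains (Suc (Suc (Suc 0))) 0 (as @ bs) = 0"
  shows "has_1_23 (as @ m # bs) \<longleftrightarrow> num_chains 2 0 (butlast as) \<noteq> num_chains 2 0 as"
  using assms
proof (induction as)
  case Nil
  then show ?case
    using has_1_23_imp_num_chains[of bs] by (auto simp: not_ascent_above_max)
next
  case (Cons x as)
  show ?case
  proof (cases "as = []")
    case True
    with Cons.prems have "\<not> ascent_above x (m # bs)"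
      using ascent_above_imp_num_chains[of x bs] by (auto simp: ascent_above_max)
    with True Cons show ?thesis by (auto simp: numeral_2_eq_2)
  next
    case False
    have "num_chains (Suc (Suc 0)) x (as @ bs) = 0"
      using Cons.prems by auto
    then have "ascent_above x (as @ m # bs) \<longleftrightarrow> x < last as"
      using ascent_above_insert_max[of as bs m x] Cons.prems False by simp
    moreover have "has_1_23 (as @ m # bs) \<longleftrightarrow> num_chains 2 0 (butlast as) \<noteq> num_chains 2 0 as"
      using Cons by simp
    \<comment> \<open>The pairs of \<open>x # as\<close> are those that start at \<open>x\<close>
      and those inside \<open>as\<close>. Neither count grows when the last letter is dropped, so
      the totals differ iff one of the two differs.\<close>
    moreover have "num_chains 2 0 (butlast as) \<le> num_chains 2 0 as"
      using num_chains_append_ge[of 2 0 "butlast as" "[last as]"] False by simp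
    ultimately show ?thesis
      using Cons.prems False num_chains_1_butlast[OF False, of x]
      by (auto simp: numeral_2_eq_2)
  qed
qed

section \<open>Growing permutations by their maximum\<close>

definition insert_at :: "nat \<Rightarrow> 'a \<Rightarrow> 'a list \<Rightarrow> 'a list" where
  "insert_at p m ys = take p ys @ m # drop p ys"

abbreviation perm_lists :: "nat \<Rightarrow> nat list set" where
  "perm_lists n \<equiv> permutations_of_set {1..n}"

text \<open>Non-inversions among the first \<open>r\<close> letters. For \<open>r\<close> up to the
  length of a permutation word, the value 0 says that its initial decreasing run has length at least
  \<open>r\<close>.\<close>

abbreviation asc_pairs :: "nat \<Rightarrow> nat list \<Rightarrow> nat" where
  "asc_pairs r xs \<equiv> num_chains 2 0 (take r xs)"

abbreviation triples :: "nat list \<Rightarrow> nat" where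
  "triples \<equiv> num_chains 3 0"

lemma perm_listsD:
  assumes "ys \<in> perm_lists n"
  shows "length ys = n" "set ys = {1..n}" "distinct ys"
  using assms length_finite_permutations_of_set[OF assms] by (auto dest: permutations_of_setD)

text \<open>Deleting the maximum and recording its position is a left inverse, which gives
  injectivity. Surjectivity follows by comparing cardinalities.\<close>

lemma bij_betw_insert_at:
  "bij_betw (\<lambda>(ys, p). insert_at p (Suc n) ys) (perm_lists n \<times> {..n}) (perm_lists (Suc n))"
proof -
  let ?f = "\<lambda>(ys, p). insert_at p (Suc n) ys"
  let ?g = "\<lambda>xs. (filter (\<lambda>y. y \<noteq> Suc n) xs, length (takeWhile (\<lambda>y. y \<noteq> Suc n) xs))"
  have inv: "?g (?f z) = z" if "z \<in> perm_lists n \<times> {..n}" for z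
  proof -
    obtain ys p where z: "z = (ys, p)" by fastforce
    with that have "ys \<in> perm_lists n" and p: "p \<le> n" by auto
    note ys = perm_listsD[OF this(1)]
    have *: "\<forall>y\<in>set ys. y \<noteq> Suc n" using ys by auto
    then have **: "\<forall>y\<in>set (take p ys). y \<noteq> Suc n" "\<forall>y\<in>set (drop p ys). y \<noteq> Suc n"
      by (auto dest: in_set_takeD in_set_dropD)
    then have "filter (\<lambda>y. y \<noteq> Suc n) (insert_at p (Suc n) ys) = ys"
      unfolding insert_at_def by simp
    moreover have "takeWhile (\<lambda>y. y \<noteq> Suc n) (insert_at p (Suc n) ys) = take p ys"
      unfolding insert_at_def using ** by (subst takeWhile_append2) auto
    ultimately show ?thesis using ys p z by simp
  qed
  then have inj: "inj_on ?f (perm_lists n \<times> {..n})"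
    by (rule inj_on_inverseI)
  have "?f ` (perm_lists n \<times> {..n}) \<subseteq> perm_lists (Suc n)"
  proof safe
    fix ys p assume "ys \<in> perm_lists n"
    note ys = perm_listsD[OF this]
    have "set (insert_at p (Suc n) ys) = insert (Suc n) (set (take p ys @ drop p ys))"
      unfolding insert_at_def by (simp del: append_take_drop_id)
    also have "\<dots> = {1..Suc n}"
      using ys by auto
    finally have 1: "set (insert_at p (Suc n) ys) = {1..Suc n}" .
    have "distinct (take p ys @ drop p ys)" using ys by simp
    moreover have "Suc n \<notin> set (take p ys @ drop p ys)" using ys by simp
    ultimately have "distinct (insert_at p (Suc n) ys)"
      unfolding insert_at_def by (auto simp del: append_take_drop_id)
    with 1 show "insert_at p (Suc n) ys \<in> perm_lists (Suc n)"
      by (rule permutations_of_setI)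
  qed
  moreover have "card (?f ` (perm_lists n \<times> {..n})) = card (perm_lists (Suc n))"
    using inj by (simp add: card_image card_cartesian_product)
  ultimately have "?f ` (perm_lists n \<times> {..n}) = perm_lists (Suc n)"
    by (intro card_subset_eq) auto
  with inj show ?thesis by (simp add: bij_betw_def)
qed

lemma sum_perm_lists_Suc:
  fixes f :: "nat list \<Rightarrow> nat"
  shows "(\<Sum>xs\<in>perm_lists (Suc n). f xs) = (\<Sum>ys\<in>perm_lists n. \<Sum>p\<le>n. f (insert_at p (Suc n) ys))"
  using sum.reindex_bij_betw[OF bij_betw_insert_at, of f n]
  by (simp add: sum.cartesian_product case_prod_unfold)

text \<open>For \<open>p < r\<close> the prefix consists of \<open>r - 1\<close> old letters and the
  maximum, which forms a pair with each of the \<open>p\<close> letters before it.\<close>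

lemma asc_pairs_insert_at:
  assumes "ys \<in> perm_lists n" "p \<le> n"
  shows "asc_pairs r (insert_at p (Suc n) ys) =
    (if r \<le> p then asc_pairs r ys else asc_pairs (r - 1) ys + p)"
proof (cases "r \<le> p")
  case True
  with assms show ?thesis by (simp add: insert_at_def perm_listsD min_absorb1)
next
  case False
  define s where "s = r - 1"
  with False have s: "r = Suc s" "p \<le> s" by auto
  note ys = perm_listsD[OF assms(1)]
  have "take r (insert_at p (Suc n) ys) = take p ys @ Suc n # take (s - p) (drop p ys)"
    using ys assms(2) s by (simp add: insert_at_def Suc_diff_le min_absorb2)
  moreover have "take p ys @ take (s - p) (drop p ys) = take s ys"
    using s by (simp flip: take_add)
  moreover have "num_chains (Suc 0) 0 (take p ys) = p"
    using ys assms(2) by (subst num_chains_1_eq_length) (auto dest: in_set_takeD)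
  moreover have "\<forall>y\<in>set (take p ys) \<union> set (take (s - p) (drop p ys)). y < Suc n"
    using ys by (auto dest!: in_set_takeD in_set_dropD)
  ultimately show ?thesis
    using num_chains_insert_max[of "take p ys" "take (s - p) (drop p ys)" "Suc n" 0 "Suc 0"] s
    by (simp add: numeral_2_eq_2)
qed

lemma triples_insert_at:
  assumes "ys \<in> perm_lists n"
  shows "triples (insert_at p (Suc n) ys) = triples ys + asc_pairs p ys"
proof -
  note ys = perm_listsD[OF assms(1)]
  have "\<forall>y\<in>set (take p ys) \<union> set (drop p ys). y < Suc n"
    using ys by (auto dest!: in_set_takeD in_set_dropD)
  then show ?thesis
    using num_chains_insert_max[of "take p ys" "drop p ys" "Suc n" 0 2]
    by (simp add: insert_at_def eval_nat_numeral)
qed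

text \<open>The two clauses serve the two ways to reach exactly one triple: it is there already and
  the insertion adds none, or the insertion creates it.\<close>

lemma has_1_23_insert_at:
  assumes "ys \<in> perm_lists n" "p \<le> n"
  shows "asc_pairs p ys = 0 \<Longrightarrow> has_1_23 (insert_at p (Suc n) ys) \<longleftrightarrow> has_1_23 ys"
    and "triples ys = 0 \<Longrightarrow> has_1_23 (insert_at p (Suc n) ys) \<longleftrightarrow> asc_pairs (p - 1) ys \<noteq> asc_pairs p ys"
proof -
  note ys = perm_listsD[OF assms(1)]
  have 1: "\<forall>y\<in>set (take p ys) \<union> set (drop p ys). y < Suc n"
    using ys by (auto dest!: in_set_takeD in_set_dropD)
  have 2: "0 \<notin> set (take p ys) \<union> set (drop p ys)"
    using ys by (auto dest!: in_set_takeD in_set_dropD)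
  show "asc_pairs p ys = 0 \<Longrightarrow> has_1_23 (insert_at p (Suc n) ys) \<longleftrightarrow> has_1_23 ys"
    using has_1_23_insert_decreasing[OF 1] 2 by (simp add: insert_at_def)
  show "triples ys = 0 \<Longrightarrow> has_1_23 (insert_at p (Suc n) ys) \<longleftrightarrow> asc_pairs (p - 1) ys \<noteq> asc_pairs p ys"
    using has_1_23_insert_max[OF 1 2] ys assms(2)
    by (simp add: insert_at_def butlast_take eval_nat_numeral)
qed

section \<open>Recurrences in \<open>n\<close> and the run length \<open>r\<close>\<close>

text \<open>Since \<open>take\<close> truncates, the decreasing word would satisfy
  \<open>asc_pairs r xs = 0\<close> for every \<open>r > n\<close>. The guard
  \<open>r \<le> n\<close> makes these entries 0.\<close>

definition num_avoid :: "nat \<Rightarrow> nat \<Rightarrow> nat" where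
  "num_avoid n r = (\<Sum>xs\<in>perm_lists n. of_bool (r \<le> n \<and> triples xs = 0 \<and> asc_pairs r xs = 0))"

definition num_once :: "nat \<Rightarrow> nat \<Rightarrow> nat" where
  "num_once n r = (\<Sum>xs\<in>perm_lists n.
     of_bool (r \<le> n \<and> triples xs = 1 \<and> \<not> has_1_23 xs \<and> asc_pairs r xs = 0))"

text \<open>Counts the pairs of an avoider with initial decreasing run at least \<open>r\<close> and a position \<open>p\<close> at
  which inserting the maximum creates the first 1-2-3, not a 1-23. The junk value \<open>p - 1 = 0\<close> at
  \<open>p = 0\<close> is harmless, as \<open>asc_pairs 0 xs = 0\<close>.\<close>

definition num_new :: "nat \<Rightarrow> nat \<Rightarrow> nat" where
  "num_new n r = (\<Sum>xs\<in>perm_lists n. \<Sum>p\<le>n.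
     of_bool (triples xs = 0 \<and> asc_pairs r xs = 0 \<and> asc_pairs (p - 1) xs = 1 \<and> asc_pairs p xs = 1))"

text \<open>The shape common to the recurrences: insertion in front lengthens the initial run by
  one, insertion at a later position \<open>p\<close> within the run ends it after \<open>p\<close>
  letters, which suffices only if \<open>s < p\<close>.\<close>

lemma sum_atMost_0_greater:
  fixes f :: "nat \<Rightarrow> nat"
  shows "(\<Sum>p\<le>n. (if p = 0 then c else 0) + (if s < p then f p else 0)) = c + (\<Sum>p=Suc s..n. f p)"
proof -
  have "(\<Sum>p\<le>n. if s < p then f p else 0) = sum f ({..n} \<inter> {p. s < p})"
    by (simp add: sum.inter_restrict)
  also have "{..n} \<inter> {p. s < p} = {Suc s..n}" by auto
  finally show ?thesis by (simp add: sum.distrib)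
qed

lemma sum_split_swap:
  fixes f :: "'a \<Rightarrow> nat"
  assumes "\<And>y. y \<in> Y \<Longrightarrow> f y = a y + (\<Sum>p\<in>I. b p y) + c y"
  shows "(\<Sum>y\<in>Y. f y) = (\<Sum>y\<in>Y. a y) + (\<Sum>p\<in>I. \<Sum>y\<in>Y. b p y) + (\<Sum>y\<in>Y. c y)"
  using assms by (simp add: sum.distrib sum.swap[of _ Y I] cong: sum.cong)

lemma asc_pairs_le_1: "r \<le> 1 \<Longrightarrow> asc_pairs r ys = 0"
  by (cases r; cases ys) (auto simp: numeral_2_eq_2)

lemma num_avoid_Suc:
  "num_avoid (Suc n) (Suc s) = num_avoid n s + (\<Sum>p=Suc s..n. num_avoid n p)"
proof -
  let ?a = "\<lambda>r ys. of_bool (r \<le> n \<and> triples ys = 0 \<and> asc_pairs r ys = 0) :: nat"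
  have "(\<Sum>p\<le>n. of_bool (Suc s \<le> Suc n \<and> triples (insert_at p (Suc n) ys) = 0 \<and>
          asc_pairs (Suc s) (insert_at p (Suc n) ys) = 0)) = ?a s ys + (\<Sum>p=Suc s..n. ?a p ys)"
    if ys: "ys \<in> perm_lists n" for ys
    unfolding sum_atMost_0_greater[symmetric]
  proof (intro sum.cong refl)
    fix p assume "p \<in> {..n}"
    then have p: "p \<le> n" by simp
    show "of_bool (Suc s \<le> Suc n \<and> triples (insert_at p (Suc n) ys) = 0 \<and>
          asc_pairs (Suc s) (insert_at p (Suc n) ys) = 0) =
        (if p = 0 then ?a s ys else 0) + (if s < p then ?a p ys else 0)"
      using num_chains_take_mono[of "Suc s" p 2 0 ys] p
      unfolding triples_insert_at[OF ys] asc_pairs_insert_at[OF ys p]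
      by (cases "s < p"; cases "p = 0") auto
  qed
  then have "num_avoid (Suc n) (Suc s) =
      num_avoid n s + (\<Sum>p=Suc s..n. num_avoid n p) + (\<Sum>ys\<in>perm_lists n. 0)"
    unfolding num_avoid_def sum_perm_lists_Suc by (intro sum_split_swap) (simp only: add_0_right)
  then show ?thesis by simp
qed

text \<open>The first two summands keep an existing triple, as in \<open>num_avoid_Suc\<close>. In
  the last one the insertion creates the triple; its position lies beyond the initial run, which
  therefore stays as it was.\<close>

lemma num_once_Suc:
  "num_once (Suc n) (Suc s) = num_once n s + (\<Sum>p=Suc s..n. num_once n p) + num_new n (Suc s)"
proof -
  let ?a = "\<lambda>r ys. of_bool (r \<le> n \<and> triples ys = 1 \<and> \<not> has_1_23 ys \<and> asc_pairs r ys = 0) :: nat"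
  let ?b = "\<lambda>p ys. of_bool (triples ys = 0 \<and> asc_pairs (Suc s) ys = 0 \<and>
    asc_pairs (p - 1) ys = 1 \<and> asc_pairs p ys = 1) :: nat"
  have "(\<Sum>p\<le>n. of_bool (Suc s \<le> Suc n \<and> triples (insert_at p (Suc n) ys) = 1 \<and>
          \<not> has_1_23 (insert_at p (Suc n) ys) \<and> asc_pairs (Suc s) (insert_at p (Suc n) ys) = 0))
      = ?a s ys + (\<Sum>p=Suc s..n. ?a p ys) + (\<Sum>p\<le>n. ?b p ys)"
    if ys: "ys \<in> perm_lists n" for ys
    unfolding sum_atMost_0_greater[symmetric] sum.distrib[symmetric]
  proof (intro sum.cong refl)
    fix p assume "p \<in> {..n}"
    then have p: "p \<le> n" by simp
    note has_1_23_insert_at[OF ys p]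
    moreover have "asc_pairs (Suc s) ys \<le> asc_pairs p ys" if "s < p"
      using that by (intro num_chains_take_mono) auto
    moreover have "asc_pairs p ys \<le> asc_pairs (Suc s) ys" "asc_pairs p ys \<le> asc_pairs s ys" if "\<not> s < p"
      using that by (auto intro!: num_chains_take_mono)
    moreover have "triples ys + asc_pairs p ys = 1 \<longleftrightarrow>
        triples ys = 0 \<and> asc_pairs p ys = 1 \<or> triples ys = 1 \<and> asc_pairs p ys = 0"
      by linarith
    ultimately show "of_bool (Suc s \<le> Suc n \<and> triples (insert_at p (Suc n) ys) = 1 \<and>
          \<not> has_1_23 (insert_at p (Suc n) ys) \<and> asc_pairs (Suc s) (insert_at p (Suc n) ys) = 0) =
        (if p = 0 then ?a s ys else 0) + (if s < p then ?a p ys else 0) + ?b p ys"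
      using p
      unfolding triples_insert_at[OF ys] asc_pairs_insert_at[OF ys p]
      by (cases "s < p"; cases "p = 0") auto
  qed
  then show ?thesis
    unfolding num_once_def num_new_def sum_perm_lists_Suc by (rule sum_split_swap)
qed

text \<open>Each counted word is split by the position \<open>t\<close> of its own maximum. For
  \<open>t = 0\<close> the maximum forms no pair and only shifts \<open>p\<close>. For
  \<open>t = 1\<close> it forms the one pair allowed, so the rest of the prefix decreases and the
  run has length 1, forcing \<open>s = 0\<close>.\<close>

lemma num_new_Suc:
  "num_new (Suc n) (Suc s) = num_new n s + (if s = 0 then \<Sum>p=2..n. num_avoid n p else 0)"
proof -
  let ?x = "\<lambda>p ys. of_bool (triples ys = 0 \<and> asc_pairs s ys = 0 \<and>
    asc_pairs (p - 1) ys = 1 \<and> asc_pairs p ys = 1) :: nat"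
  let ?a = "\<lambda>p ys. of_bool (p \<le> n \<and> triples ys = 0 \<and> asc_pairs p ys = 0) :: nat"
  let ?f = "\<lambda>p zs. of_bool (triples zs = 0 \<and> asc_pairs (Suc s) zs = 0 \<and>
    asc_pairs (p - 1) zs = 1 \<and> asc_pairs p zs = 1) :: nat"
  have "(\<Sum>t\<le>n. \<Sum>p\<le>Suc n. ?f p (insert_at t (Suc n) ys)) =
      (\<Sum>p\<le>n. ?x p ys) + (\<Sum>p\<in>(if s = 0 then {2..n} else {}). ?a p ys)"
    if ys: "ys \<in> perm_lists n" for ys
  proof -
    have *: "?f (Suc p) (insert_at t (Suc n) ys) =
        (if t = 0 then ?x p ys else 0) +
        (if t = 1 then (if 1 < p then if s = 0 then ?a p ys else 0 else 0) else 0)"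
      if "p \<le> n" "t \<le> n" for p t
    proof -
      have pred: "asc_pairs (p - 1) ys \<le> asc_pairs p ys"
        by (intro num_chains_take_mono) auto
      have less: "asc_pairs (Suc p) ys \<le> asc_pairs t ys" if "p < t"
        using that by (intro num_chains_take_mono) auto
      have le_1: "asc_pairs p ys = 0" if "p \<le> 1"
        using that by (rule asc_pairs_le_1)
      have 0: "asc_pairs 1 ys = 0" "asc_pairs 0 ys = 0"
        by (auto intro: asc_pairs_le_1)
      \<comment> \<open>For \<open>t \<ge> 2\<close> nothing is counted: the maximum either lies in
        the prefix and forms two pairs, or follows the prefix and completes a triple with its
        pair.\<close>
      consider "t = 0" | "t = 1" "p \<le> 1" | "t = 1" "1 < p" | "t \<ge> 2" by linarith
      then show ?thesis
      proof cases
        case 1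
        then show ?thesis
          unfolding triples_insert_at[OF ys] asc_pairs_insert_at[OF ys that(2)]
          by simp
      next
        case 2
        then show ?thesis
          using 0 le_1
          unfolding triples_insert_at[OF ys] asc_pairs_insert_at[OF ys that(2)]
          by (cases "p = 1") auto
      next
        case 3
        then show ?thesis
          using 0 pred that
          unfolding triples_insert_at[OF ys] asc_pairs_insert_at[OF ys that(2)]
          by auto
      next
        case 4
        then show ?thesis
          using less
          unfolding triples_insert_at[OF ys] asc_pairs_insert_at[OF ys that(2)]
          by (cases "p < t") auto
      qed
    qed
    \<comment> \<open>The term \<open>p = 0\<close> vanishes because an empty prefix has no
      pair.\<close>
    have "(\<Sum>t\<le>n. \<Sum>p\<le>Suc n. ?f p (insert_at t (Suc n) ys)) =
        (\<Sum>t\<le>n. \<Sum>p\<le>n. ?f (Suc p) (insert_at t (Suc n) ys))"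
      using asc_pairs_le_1[of 0] by (subst sum.atMost_Suc_shift) simp
    also have "\<dots> = (\<Sum>t\<le>n. \<Sum>p\<le>n. (if t = 0 then ?x p ys else 0) +
        (if t = 1 then (if 1 < p then if s = 0 then ?a p ys else 0 else 0) else 0))"
      using * by (intro sum.cong refl) auto
    also have "\<dots> = (\<Sum>p\<le>n. \<Sum>t\<le>n. (if t = 0 then ?x p ys else 0) +
        (if t = 1 then (if 1 < p then if s = 0 then ?a p ys else 0 else 0) else 0))"
      by (rule sum.swap)
    \<comment> \<open>The null summand gives the shape of \<open>sum_atMost_0_greater\<close> with
      \<open>s = 1\<close>.\<close>
    also have "\<dots> = (\<Sum>p\<le>n. ?x p ys + ((if p = 0 then 0 else 0) + (if 1 < p then if s = 0 then ?a p ys else 0 else 0)))"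
      by (intro sum.cong refl) (auto simp: sum.distrib)
    also have "\<dots> = (\<Sum>p\<le>n. ?x p ys) + (0 + (\<Sum>p=2..n. if s = 0 then ?a p ys else 0))"
      unfolding sum.distrib[of "\<lambda>p. ?x p ys"] sum_atMost_0_greater Suc_1 ..
    also have "0 + (\<Sum>p=2..n. if s = 0 then ?a p ys else 0) =
        (\<Sum>p\<in>(if s = 0 then {2..n} else {}). ?a p ys)"
      by (cases "s = 0") simp_all
    finally show ?thesis .
  qed
  then have "num_new (Suc n) (Suc s) =
      num_new n s + (\<Sum>p\<in>(if s = 0 then {2..n} else {}). num_avoid n p) + (\<Sum>ys\<in>perm_lists n. 0)"
    unfolding num_avoid_def num_new_def sum_perm_lists_Suc
    by (intro sum_split_swap) (simp only: add_0_right)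
  then show ?thesis by simp
qed

lemma num_avoid_0: "num_avoid (Suc n) 0 = num_avoid (Suc n) (Suc 0)"
  by (simp add: num_avoid_def asc_pairs_le_1)

lemma num_once_0: "num_once (Suc n) 0 = num_once (Suc n) (Suc 0)"
  by (simp add: num_once_def asc_pairs_le_1)

lemma num_new_0: "num_new n 0 = num_new n (Suc 0)"
  by (simp add: num_new_def asc_pairs_le_1)

lemma num_avoid_eq_0: "n < r \<Longrightarrow> num_avoid n r = 0"
  by (simp add: num_avoid_def)

lemma num_once_eq_0: "n < r \<Longrightarrow> num_once n r = 0"
  by (simp add: num_once_def)

lemma sum_from_Suc:
  fixes f :: "nat \<Rightarrow> nat"
  assumes "\<And>r. n < r \<Longrightarrow> f r = 0"
  shows "f s + (\<Sum>p=Suc s..n. f p) = (\<Sum>p=s..n. f p)"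
  using assms by (cases "s \<le> n") (auto simp: sum.atLeast_Suc_atMost)

text \<open>By \<open>sum_from_Suc\<close> both entries of row \<open>Suc n\<close> are tail sums of
  row \<open>n\<close>, and consecutive tail sums differ by one term.\<close>

lemma num_avoid_rec:
  "num_avoid (Suc n) (Suc r) = num_avoid n r + num_avoid (Suc n) (Suc (Suc r))"
  unfolding num_avoid_Suc[of n r] num_avoid_Suc[of n "Suc r"]
  by (simp add: sum_from_Suc num_avoid_eq_0)

lemma num_once_rec:
  "num_once (Suc n) (Suc r) + num_new n (Suc (Suc r)) =
    num_once n r + num_once (Suc n) (Suc (Suc r)) + num_new n (Suc r)"
  unfolding num_once_Suc[of n r] num_once_Suc[of n "Suc r"]
  by (simp add: sum_from_Suc num_once_eq_0)

text \<open>By \<open>num_new_Suc\<close> the difference is constant along diagonals until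
  \<open>r = 0\<close>. There \<open>num_new_0\<close> cancels the \<open>num_new\<close> terms, and
  the remaining sum of avoiders is an entry of column 3.\<close>

lemma num_new_diff:
  "int (num_new n (Suc r)) - int (num_new n (Suc (Suc r))) =
    (if r < n then int (num_avoid (n - r) 3) else 0)"
proof (induction n arbitrary: r)
  case 0
  then show ?case by (simp add: num_new_def numeral_2_eq_2)
next
  case (Suc n)
  have "num_avoid (Suc n) 3 = (\<Sum>p=2..n. num_avoid n p)"
    using num_avoid_Suc[of n 2] sum_from_Suc[of n "num_avoid n" 2] num_avoid_eq_0[of n]
    by (simp add: eval_nat_numeral)
  with Suc.IH show ?case
    by (cases r) (auto simp: num_new_Suc num_new_0)
qed

section \<open>Solving the recurrences by generating functions\<close>

text \<open>The recurrence is not a plain recursion on \<open>n\<close>: row \<open>Suc n\<close> is determined from right to left,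
  starting with the zeros beyond the diagonal.\<close>

lemma ascent_recurrence_unique:
  fixes u v w :: "nat \<Rightarrow> nat \<Rightarrow> real"
  assumes u: "\<And>n r. u (Suc n) (Suc r) = u n r + u (Suc n) (Suc (Suc r)) + w n r"
    and v: "\<And>n r. v (Suc n) (Suc r) = v n r + v (Suc n) (Suc (Suc r)) + w n r"
    and eq_0: "\<And>n r. n < r \<Longrightarrow> u n r = 0" "\<And>n r. n < r \<Longrightarrow> v n r = 0"
    and first: "\<And>n. u (Suc n) 0 = u (Suc n) (Suc 0)" "\<And>n. v (Suc n) 0 = v (Suc n) (Suc 0)"
    and start: "u 0 0 = v 0 0"
  shows "u n r = v n r"
proof (induction n arbitrary: r)
  case 0
  show ?case using start eq_0 by (cases r) auto
next
  case (Suc n)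
  note IH = Suc.IH
  have *: "u (Suc n) (Suc r) = v (Suc n) (Suc r)" for r
  proof (induction "Suc n - r" arbitrary: r)
    case 0
    then show ?case using eq_0 by simp
  next
    case (Suc k)
    then have "u (Suc n) (Suc (Suc r)) = v (Suc n) (Suc (Suc r))" by simp
    then show ?case unfolding u[of n r] v[of n r] IH by simp
  qed
  then show ?case using first by (cases r) auto
qed

lemma catalan_gf_rec: "catalan_gf = 1 + fps_X * catalan_gf ^ 2"
proof -
  let ?s = "1 - fps_const 4 * fps_X :: real fps"
  define r where "r = fps_radical root 2 ?s"
  have r2: "r ^ 2 = ?s"
    using power_radical[of ?s root 1] unfolding r_def by (simp add: numeral_2_eq_2)
  have r0: "r $ 0 = 1" by (simp add: r_def)
  \<comment> \<open>The constant term of \<open>1 - r\<close> is 0, so the division in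
    \<open>catalan_gf_def\<close> is exact and can be undone.\<close>
  have "1 - r = (fps_const 2 * fps_X) * (fps_const (1/2) * fps_shift 1 (1 - r))"
    by (rule fps_ext) (simp add: r0 mult.assoc fps_X_mult_nth mult.left_commute[of fps_X])
  then have "(fps_const 2 * fps_X) dvd (1 - r)" ..
  then have "catalan_gf * (fps_const 2 * fps_X) = 1 - r"
    unfolding catalan_gf_def r_def by (rule dvd_div_mult_self)
  then have "r = 1 - catalan_gf * (2 * fps_X)"
    by (simp add: algebra_simps numeral_fps_const)
  with r2 have "(1 - catalan_gf * (2 * fps_X)) ^ 2 = 1 - 4 * fps_X"
    by (simp add: numeral_fps_const)
  then have "(4 * fps_X) * catalan_gf = (4 * fps_X) * (1 + fps_X * catalan_gf ^ 2)"
    by algebra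
  then show ?thesis by simp
qed

lemma catalan_gf_nth_0: "catalan_gf $ 0 = 1"
  by (subst catalan_gf_rec) simp

text \<open>For \<open>?F r\<close>, the recurrence is \<open>C = 1 + x C^2\<close> multiplied by
  \<open>x^(r+1) C^(r+1)\<close>.\<close>

lemma num_avoid_gf: "real (num_avoid n r) = (fps_X ^ r * catalan_gf ^ Suc r) $ n"
proof (rule ascent_recurrence_unique[where u = "\<lambda>n r. real (num_avoid n r)" and w = "\<lambda>_ _. 0"
      and v = "\<lambda>n r. (fps_X ^ r * catalan_gf ^ Suc r) $ n"])
  let ?F = "\<lambda>r. fps_X ^ r * catalan_gf ^ Suc r"
  have step: "?F (Suc r) = fps_X * ?F r + ?F (Suc (Suc r))" for r
  proof -
    have "?F (Suc r) - fps_X * ?F r - ?F (Suc (Suc r)) =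
        fps_X ^ Suc r * catalan_gf ^ Suc r * (catalan_gf - (1 + fps_X * catalan_gf ^ 2))"
      by (simp add: algebra_simps power2_eq_square)
    also have "\<dots> = 0"
      using catalan_gf_rec by simp
    finally show ?thesis
      by (simp only: diff_diff_eq right_minus_eq)
  qed
  show "?F (Suc r) $ Suc n = ?F r $ n + ?F (Suc (Suc r)) $ Suc n + 0" for n r
    by (subst step) (simp only: fps_add_nth fps_X_mult_nth nat.distinct if_False diff_Suc_1 add_0_right)
  show "?F r $ n = 0" if "n < r" for n r
    using that by (simp add: fps_X_power_mult_nth)
  \<comment> \<open>Columns 0 and 1 differ only in the constant term, which coefficients at
    \<open>Suc n\<close> do not see.\<close>
  have first: "?F 0 = 1 + ?F (Suc 0)"
    using catalan_gf_rec by (simp add: power2_eq_square)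
  show "?F 0 $ Suc n = ?F (Suc 0) $ Suc n" for n
    by (subst first) (simp only: fps_add_nth fps_one_nth nat.distinct if_False add_0_left)
  show "real (num_avoid 0 0) = ?F 0 $ 0"
    by (simp add: catalan_gf_nth_0 num_avoid_def eval_nat_numeral)
  show "real (num_avoid (Suc n) (Suc r)) = real (num_avoid n r) + real (num_avoid (Suc n) (Suc (Suc r))) + 0"
    for n r
    by (subst num_avoid_rec) simp
qed (simp_all add: num_avoid_eq_0 num_avoid_0)

text \<open>The source term \<open>w\<close> comes from \<open>num_new_diff\<close>. A particular
  solution is \<open>- x^(r+2) C^4\<close>; to it is added the homogeneous solution
  \<open>x^r C^(r+1)\<close> times \<open>x^2 C^4 (1 - x)\<close>, a factor chosen to make columns 0
  and 1 agree.\<close>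

lemma num_once_gf:
  "real (num_once n r) =
    (fps_X ^ (r + 2) * catalan_gf ^ 4 * (catalan_gf ^ Suc r * (1 - fps_X) - 1)) $ n"
proof (rule ascent_recurrence_unique[where u = "\<lambda>n r. real (num_once n r)"
      and w = "\<lambda>n r. (fps_X ^ (r + 3) * catalan_gf ^ 4) $ n"
      and v = "\<lambda>n r. (fps_X ^ (r + 2) * catalan_gf ^ 4 * (catalan_gf ^ Suc r * (1 - fps_X) - 1)) $ n"])
  let ?C = "catalan_gf"
  let ?G = "\<lambda>r. fps_X ^ (r + 2) * ?C ^ 4 * (?C ^ Suc r * (1 - fps_X) - 1)"
  let ?w = "\<lambda>r. fps_X ^ (r + 3) * ?C ^ 4"
  show "real (num_once (Suc n) (Suc r)) =
      real (num_once n r) + real (num_once (Suc n) (Suc (Suc r))) + ?w r $ n" for n r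
  proof -
    have "?w r = fps_X ^ r * (fps_X ^ 3 * ?C ^ Suc 3)"
      by (simp add: power_add mult_ac)
    then have "?w r $ n = (if n < r then 0 else real (num_avoid (n - r) 3))"
      by (simp only: fps_X_power_mult_nth num_avoid_gf)
    also have "\<dots> = real (num_new n (Suc r)) - real (num_new n (Suc (Suc r)))"
      \<comment> \<open>At \<open>n = r\<close> the two case distinctions differ, but
        \<open>num_avoid 0 3 = 0\<close>.\<close>
      using arg_cong[OF num_new_diff[of n r], of real_of_int] num_avoid_eq_0[of 0 3]
      by (cases n r rule: linorder_cases) auto
    finally show ?thesis
      using arg_cong[OF num_once_rec[of n r], of real] by simp
  qed
  have step: "?G (Suc r) = fps_X * ?G r + ?G (Suc (Suc r)) + fps_X * ?w r" for r
  proof -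
    have "?G (Suc r) - fps_X * ?G r - ?G (Suc (Suc r)) - fps_X * ?w r =
        fps_X ^ (r + 3) * ?C ^ 4 * ?C ^ Suc r * (1 - fps_X) * (?C - (1 + fps_X * ?C ^ 2))"
      by (simp add: algebra_simps power2_eq_square power3_eq_cube power_add)
    also have "\<dots> = 0"
      using catalan_gf_rec by simp
    finally show ?thesis
      by (simp only: diff_diff_eq right_minus_eq)
  qed
  show "?G (Suc r) $ Suc n = ?G r $ n + ?G (Suc (Suc r)) $ Suc n + ?w r $ n" for n r
    by (subst step) (simp only: fps_add_nth fps_X_mult_nth nat.distinct if_False diff_Suc_1)
  show "?G r $ n = 0" if "n < r" for n r
    using that by (simp only: mult.assoc fps_X_power_mult_nth) simp
  have "?G 0 - ?G (Suc 0) = fps_X ^ 2 * ?C ^ 4 * (1 - fps_X) * (?C - (1 + fps_X * ?C ^ 2))"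
    by (simp add: algebra_simps power2_eq_square power3_eq_cube)
  also have "\<dots> = 0"
    using catalan_gf_rec by simp
  finally have "?G 0 = ?G (Suc 0)"
    by (simp only: right_minus_eq)
  then show "?G 0 $ Suc n = ?G (Suc 0) $ Suc n" for n
    by (simp only:)
  show "real (num_once 0 0) = ?G 0 $ 0"
    by (simp add: num_once_def eval_nat_numeral)
qed (simp_all add: num_once_eq_0 num_once_0)

section \<open>Coefficients of powers of the Catalan series\<close>

lemma catalan_gf_power_nth_rec:
  "(catalan_gf ^ Suc k) $ Suc m = (catalan_gf ^ k) $ Suc m + (catalan_gf ^ (k + 2)) $ m"
proof -
  have "catalan_gf ^ Suc k = catalan_gf ^ k * (1 + fps_X * catalan_gf ^ 2)"
    using catalan_gf_rec by simp
  also have "\<dots> = catalan_gf ^ k + fps_X * catalan_gf ^ (k + 2)"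
    by (simp add: algebra_simps power_add power2_eq_square)
  finally have "catalan_gf ^ Suc k = catalan_gf ^ k + fps_X * catalan_gf ^ (k + 2)" .
  then show ?thesis
    by (simp only: fps_add_nth fps_X_mult_nth nat.distinct if_False diff_Suc_1)
qed

text \<open>Ballot numbers. The recurrence lowers either \<open>k\<close> or \<open>m\<close>,
  raising \<open>k\<close> by 2 in the latter case, so the outer induction on \<open>m\<close> is
  over all \<open>k\<close>; the step is Pascal's rule for both binomials.\<close>

lemma catalan_gf_power_nth_Suc:
  "(catalan_gf ^ k) $ Suc m = real ((2 * m + 1 + k) choose Suc m) - real ((2 * m + 1 + k) choose m)"
proof (induction m arbitrary: k)
  case 0
  have C0: "(catalan_gf ^ j) $ 0 = 1" for j
    by (simp add: catalan_gf_nth_0 fps_power_zeroth)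
  show ?case
  proof (induction k)
    case (Suc k)
    then show ?case unfolding catalan_gf_power_nth_rec C0 by simp
  qed simp
next
  case (Suc m)
  note IH = Suc.IH
  show ?case
  proof (induction k)
    case 0
    have "(2 * Suc m + 1) choose Suc (Suc m) = (2 * Suc m + 1) choose Suc m"
      using binomial_symmetric[of "Suc m" "2 * Suc m + 1"] by simp
    then show ?case by simp
  next
    case (Suc k)
    have "2 * m + 1 + (k + 2) = 2 * Suc m + 1 + k" "2 * Suc m + 1 + Suc k = Suc (2 * Suc m + 1 + k)"
      by simp_all
    then show ?case
      unfolding catalan_gf_power_nth_rec Suc.IH IH by (simp only: binomial_Suc_Suc of_nat_add)
  qed
qed

text \<open>Absorption expresses the subtracted binomial as \<open>(k+1)/(k+8)\<close> times the
  other one, which leaves the factor \<open>7/(k+8)\<close> with \<open>m = Suc k\<close>.\<close>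

lemma catalan_gf_power_7_nth:
  "(catalan_gf ^ 7) $ m = 7 / (real m + 7) * real ((2 * m + 6) choose (m + 6))"
proof (cases m)
  case 0
  have "(catalan_gf ^ 7) $ 0 = 1"
    by (simp add: catalan_gf_nth_0 fps_power_zeroth)
  with 0 show ?thesis by simp
next
  case (Suc k)
  let ?b = "(2 * k + 8) choose k"
  have "Suc k * ((2 * k + 8) choose Suc k) = (2 * k + 8 - k) * ?b"
    unfolding binomial_absorption binomial_absorb_comp ..
  then have "real (Suc k * ((2 * k + 8) choose Suc k)) = real ((k + 8) * ?b)"
    by simp
  then have "real ?b = real (Suc k) / (real k + 8) * real ((2 * k + 8) choose Suc k)"
    unfolding of_nat_mult by (simp add: field_simps)
  moreover have "(2 * k + 8) choose Suc k = (2 * k + 8) choose (k + 7)"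
    using binomial_symmetric[of "Suc k" "2 * k + 8"] by (simp add: add.commute)
  moreover have "(catalan_gf ^ 7) $ m = real ((2 * k + 8) choose Suc k) - real ?b"
    using catalan_gf_power_nth_Suc[of 7 k] Suc by (simp add: add.commute)
  ultimately have "(catalan_gf ^ 7) $ m = 7 / (real k + 8) * real ((2 * k + 8) choose (k + 7))"
    by (simp only:) (simp add: field_simps)
  then show ?thesis
    using Suc by (simp add: add.commute)
qed

section \<open>From words back to permutations as functions\<close>

text \<open>A first position in \<open>y # ys\<close> is 0 or a successor, so this split matches the
  last clause of \<open>num_chains\<close>.\<close>

lemma card_Suc_split:
  fixes S :: "(nat \<times> 'b) set"
  assumes "finite S"
  shows "card S = card {t. (0, t) \<in> S} + card {(i, t). (Suc i, t) \<in> S}"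
proof -
  have S: "S = Pair 0 ` {t. (0, t) \<in> S} \<union> map_prod Suc id ` {(i, t). (Suc i, t) \<in> S}"
  proof (intro equalityI subsetI)
    fix z assume "z \<in> S"
    then show "z \<in> Pair 0 ` {t. (0, t) \<in> S} \<union> map_prod Suc id ` {(i, t). (Suc i, t) \<in> S}"
      by (cases z; cases "fst z") (auto simp: image_iff)
  qed auto
  have "Pair 0 ` {t. (0, t) \<in> S} \<subseteq> S" "map_prod Suc id ` {(i, t). (Suc i, t) \<in> S} \<subseteq> S"
    by auto
  then have fin: "finite (Pair (0::nat) ` {t. (0, t) \<in> S})" "finite (map_prod Suc id ` {(i, t). (Suc i, t) \<in> S})"
    by (simp_all add: finite_subset[OF _ assms])
  have "card S = card (Pair (0::nat) ` {t. (0, t) \<in> S}) + card (map_prod Suc id ` {(i, t). (Suc i, t) \<in> S})"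
    by (subst S, rule card_Un_disjoint) (use fin in auto)
  also have "card (Pair (0::nat) ` {t. (0, t) \<in> S}) = card {t. (0, t) \<in> S}"
    by (rule card_image) (auto intro: inj_onI)
  also have "card (map_prod Suc id ` {(i, t). (Suc i, t) \<in> S}) = card {(i, t). (Suc i, t) \<in> S}"
    by (rule card_image) (auto intro: inj_onI)
  finally show ?thesis .
qed

lemma num_chains_1_card: "num_chains (Suc 0) x xs = card {i. i < length xs \<and> x < xs ! i}"
proof (induction xs)
  case (Cons y xs)
  have "{i. i < length (y # xs) \<and> x < (y # xs) ! i} =
      (if x < y then {0} else {}) \<union> Suc ` {i. i < length xs \<and> x < xs ! i}"
    by (auto simp: image_iff less_Suc_eq_0_disj)
  also have "card \<dots> = of_bool (x < y) + card (Suc ` {i. i < length xs \<and> x < xs ! i})"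
    by (subst card_Un_disjoint) auto
  finally show ?case
    using Cons.IH by (simp add: card_image)
qed simp

lemma num_chains_2_card:
  "num_chains (Suc (Suc 0)) x xs =
    card {(i, j). i < j \<and> j < length xs \<and> x < xs ! i \<and> xs ! i < xs ! j}"
proof (induction xs)
  case (Cons y xs)
  let ?S = "{(i, j). i < j \<and> j < length (y # xs) \<and> x < (y # xs) ! i \<and> (y # xs) ! i < (y # xs) ! j}"
  have "finite ?S"
    by (rule finite_subset[of _ "{..length xs} \<times> {..length xs}"]) auto
  then have "card ?S = card {j. (0, j) \<in> ?S} + card {(i, j). (Suc i, j) \<in> ?S}"
    by (rule card_Suc_split)
  also have "{j. (0, j) \<in> ?S} = Suc ` (if x < y then {j. j < length xs \<and> y < xs ! j} else {})"
    by (auto simp: image_iff gr0_conv_Suc)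
  also have "{(i, j). (Suc i, j) \<in> ?S} =
      map_prod id Suc ` {(i, j). i < j \<and> j < length xs \<and> x < xs ! i \<and> xs ! i < xs ! j}"
    by (auto simp: image_iff Suc_less_eq2)
  finally show ?case
    using Cons.IH by (simp add: card_image num_chains_1_card inj_on_def)
qed simp

lemma num_chains_3_card:
  "num_chains (Suc (Suc (Suc 0))) x xs =
    card {(i, j, m). i < j \<and> j < m \<and> m < length xs \<and> x < xs ! i \<and> xs ! i < xs ! j \<and> xs ! j < xs ! m}"
proof (induction xs)
  case (Cons y xs)
  let ?S = "{(i, j, m). i < j \<and> j < m \<and> m < length (y # xs) \<and> x < (y # xs) ! i \<and>
    (y # xs) ! i < (y # xs) ! j \<and> (y # xs) ! j < (y # xs) ! m}"
  have "finite ?S"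
    by (rule finite_subset[of _ "{..length xs} \<times> {..length xs} \<times> {..length xs}"]) auto
  then have "card ?S = card {t. (0, t) \<in> ?S} + card {(i, t). (Suc i, t) \<in> ?S}"
    by (rule card_Suc_split)
  also have "{t. (0, t) \<in> ?S} = map_prod Suc Suc `
      (if x < y then {(j, m). j < m \<and> m < length xs \<and> y < xs ! j \<and> xs ! j < xs ! m} else {})"
    by (auto simp: image_iff gr0_conv_Suc Suc_less_eq2)
  also have "{(i, t). (Suc i, t) \<in> ?S} = map_prod id (map_prod Suc Suc) `
      {(i, j, m). i < j \<and> j < m \<and> m < length xs \<and> x < xs ! i \<and> xs ! i < xs ! j \<and> xs ! j < xs ! m}"
    by (auto simp: image_iff Suc_less_eq2)
  finally show ?case
    using Cons.IH by (simp add: card_image num_chains_2_card inj_on_def)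
qed simp

lemma ascent_above_iff:
  "ascent_above x xs \<longleftrightarrow> (\<exists>j. Suc j < length xs \<and> x < xs ! j \<and> xs ! j < xs ! Suc j)"
proof (induction x xs rule: ascent_above.induct)
  case (1 x y z zs)
  have "(\<exists>j. P j) \<longleftrightarrow> P 0 \<or> (\<exists>j. P (Suc j))" for P :: "nat \<Rightarrow> bool"
    by (metis not0_implies_Suc)
  from this[of "\<lambda>j. Suc j < length (y # z # zs) \<and> x < (y # z # zs) ! j \<and> (y # z # zs) ! j < (y # z # zs) ! Suc j"]
  show ?case using 1 by simp
qed simp_all

lemma has_1_23_iff:
  "has_1_23 xs \<longleftrightarrow>
    (\<exists>i j. i < j \<and> Suc j < length xs \<and> xs ! i < xs ! j \<and> xs ! j < xs ! Suc j)"
proof (induction xs)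
  case (Cons x xs)
  have split: "(\<exists>j. P j) \<longleftrightarrow> P 0 \<or> (\<exists>j. P (Suc j))" for P :: "nat \<Rightarrow> bool"
    by (metis not0_implies_Suc)
  show ?case
    unfolding has_1_23.simps Cons.IH ascent_above_iff
    by (subst (2) split, subst (3 4) split) simp
qed simp

text \<open>One-line notation. It is injective because a permutation of \<open>{1..n}\<close> fixes
  everything outside, and surjective by cardinality.\<close>

lemma bij_betw_perm_lists:
  "bij_betw (\<lambda>\<pi>. map \<pi> [1..<Suc n]) {\<pi>. \<pi> permutes {1..n}} (perm_lists n)"
proof -
  let ?f = "\<lambda>\<pi>. map \<pi> [1..<Suc n]"
  have set: "set [1..<Suc n] = {1..n}" by auto
  have inj: "inj_on ?f {\<pi>. \<pi> permutes {1..n}}"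
  proof (rule inj_onI)
    fix \<pi> \<sigma> :: "nat \<Rightarrow> nat"
    assume perm: "\<pi> \<in> {\<pi>. \<pi> permutes {1..n}}" "\<sigma> \<in> {\<pi>. \<pi> permutes {1..n}}"
      and "?f \<pi> = ?f \<sigma>"
    then have "\<forall>i\<in>{1..n}. \<pi> i = \<sigma> i"
      unfolding map_eq_conv set by simp
    with perm show "\<pi> = \<sigma>"
      by (metis ext mem_Collect_eq permutes_not_in)
  qed
  have "?f ` {\<pi>. \<pi> permutes {1..n}} \<subseteq> perm_lists n"
  proof safe
    fix \<pi> assume perm: "\<pi> permutes {1..n}"
    show "?f \<pi> \<in> perm_lists n"
    proof (rule permutations_of_setI)
      show "set (?f \<pi>) = {1..n}"
        unfolding set_map set by (rule permutes_image[OF perm])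
      show "distinct (?f \<pi>)"
        unfolding distinct_map using permutes_inj_on[OF perm] by simp
    qed
  qed
  moreover have "card (?f ` {\<pi>. \<pi> permutes {1..n}}) = card (perm_lists n)"
    using inj by (simp add: card_image card_permutations[OF refl])
  ultimately have "?f ` {\<pi>. \<pi> permutes {1..n}} = perm_lists n"
    by (intro card_subset_eq) auto
  with inj show ?thesis by (simp add: bij_betw_def)
qed

text \<open>The \<open>Suc\<close> maps pass from 0-based list positions to 1-based ones; the bound
  \<open>0\<close> in \<open>triples\<close> holds because all letters are positive.\<close>

lemma card_occs_1_2_3:
  assumes "\<pi> permutes {1..n}"
  shows "card (occs_1_2_3 n \<pi>) = triples (map \<pi> [1..<Suc n])"
proof -
  let ?xs = "map \<pi> [1..<Suc n]"
  let ?S = "{(i, j, m). i < j \<and> j < m \<and> m < length ?xs \<and> 0 < ?xs ! i \<and> ?xs ! i < ?xs ! j \<and> ?xs ! j < ?xs ! m}"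
  have pos: "0 < \<pi> (Suc i)" if "i < n" for i
    using permutes_in_image[OF assms, of "Suc i"] that by simp
  have "occs_1_2_3 n \<pi> = map_prod Suc (map_prod Suc Suc) ` ?S"
  proof (intro equalityI subsetI)
    fix z assume "z \<in> occs_1_2_3 n \<pi>"
    then obtain i j m where z: "z = (i, j, m)" "1 \<le> i" "i < j" "j < m" "m \<le> n" "\<pi> i < \<pi> j" "\<pi> j < \<pi> m"
      by (auto simp: occs_1_2_3_def)
    then obtain i' j' m' where "i = Suc i'" "j = Suc j'" "m = Suc m'"
      by (cases i; cases j; cases m) auto
    with z show "z \<in> map_prod Suc (map_prod Suc Suc) ` ?S"
      by (intro image_eqI[of _ _ "(i', j', m')"]) (auto simp: pos simp del: upt_Suc)
  qed (auto simp: occs_1_2_3_def simp del: upt_Suc)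
  then have "card (occs_1_2_3 n \<pi>) = card ?S"
    by (simp add: card_image inj_on_def)
  then show ?thesis
    by (simp only: num_chains_3_card numeral_3_eq_3)
qed

lemma card_occs_1_23_eq_0_iff: "card (occs_1_23 n \<pi>) = 0 \<longleftrightarrow> \<not> has_1_23 (map \<pi> [1..<Suc n])"
proof -
  \<comment> \<open>An infinite set would have \<open>card\<close> 0 as well.\<close>
  have "finite (occs_1_23 n \<pi>)"
    by (rule finite_subset[of _ "{..n} \<times> {..n} \<times> {..n}"]) (auto simp: occs_1_23_def occs_1_2_3_def)
  moreover have "occs_1_23 n \<pi> \<noteq> {} \<longleftrightarrow> has_1_23 (map \<pi> [1..<Suc n])"
    unfolding has_1_23_iff
  proof
    assume "occs_1_23 n \<pi> \<noteq> {}"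
    then obtain i j where ij: "1 \<le> i" "i < j" "j < n" "\<pi> i < \<pi> j" "\<pi> j < \<pi> (Suc j)"
      by (auto simp: occs_1_23_def occs_1_2_3_def)
    then obtain i' j' where "i = Suc i'" "j = Suc j'"
      by (cases i; cases j) auto
    with ij show "\<exists>i j. i < j \<and> Suc j < length (map \<pi> [1..<Suc n]) \<and>
        map \<pi> [1..<Suc n] ! i < map \<pi> [1..<Suc n] ! j \<and>
        map \<pi> [1..<Suc n] ! j < map \<pi> [1..<Suc n] ! Suc j"
      by (intro exI[of _ i'] exI[of _ j']) (simp del: upt_Suc)
  next
    assume "\<exists>i j. i < j \<and> Suc j < length (map \<pi> [1..<Suc n]) \<and>
        map \<pi> [1..<Suc n] ! i < map \<pi> [1..<Suc n] ! j \<and>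
        map \<pi> [1..<Suc n] ! j < map \<pi> [1..<Suc n] ! Suc j"
    then obtain i j where "i < j" "Suc j < n" "\<pi> (Suc i) < \<pi> (Suc j)" "\<pi> (Suc j) < \<pi> (Suc (Suc j))"
      by (auto simp del: upt_Suc)
    then have "(Suc i, Suc j, Suc (Suc j)) \<in> occs_1_23 n \<pi>"
      by (simp add: occs_1_23_def occs_1_2_3_def)
    then show "occs_1_23 n \<pi> \<noteq> {}" by blast
  qed
  ultimately show ?thesis by auto
qed

lemma d_seq_eq_num_once: "d_seq n = num_once n 0"
proof -
  let ?P = "{\<pi>. \<pi> permutes {1..n}}" and ?f = "\<lambda>\<pi>. map \<pi> [1..<Suc n]"
  let ?Q = "\<lambda>xs. triples xs = 1 \<and> \<not> has_1_23 xs"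
  have "{\<pi> \<in> perms_with_occs occs_1_2_3 1 n. card (occs_1_23 n \<pi>) = 0} = {\<pi> \<in> ?P. ?Q (?f \<pi>)}"
    unfolding perms_with_occs_def card_occs_1_23_eq_0_iff
    by (auto simp: card_occs_1_2_3 simp del: upt_Suc)
  moreover have "bij_betw ?f {\<pi> \<in> ?P. ?Q (?f \<pi>)} {xs \<in> perm_lists n. ?Q xs}"
    using bij_betw_perm_lists[of n] unfolding bij_betw_def inj_on_def by (auto simp del: upt_Suc)
  ultimately have "d_seq n = card {xs \<in> perm_lists n. ?Q xs}"
    unfolding d_seq_def by (simp only: bij_betw_same_card)
  also have "\<dots> = num_once n 0"
    by (simp add: num_once_def Int_def)
  finally show ?thesis .
qed

theorem theorem10:
  shows "Abs_fps (\<lambda>n. if n \<ge> 4 then real (d_seq n) else 0) = fps_X ^ 4 * catalan_gf ^ 7 \<and>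
    fps_X ^ 4 * catalan_gf ^ 7 =
      Abs_fps (\<lambda>n. if n \<ge> 4 then 7 / (real n + 3) * real ((2 * n - 2) choose (n + 2)) else 0)"
proof
  \<comment> \<open>From \<open>C - 1 = x C^2\<close> follows
    \<open>C - 1 - x C = x C (C - 1) = x^2 C^3\<close>.\<close>
  have "catalan_gf * (1 - fps_X) - 1 = fps_X ^ 2 * catalan_gf ^ 3"
    using catalan_gf_rec by algebra
  then have "fps_X ^ (0 + 2) * catalan_gf ^ 4 * (catalan_gf ^ Suc 0 * (1 - fps_X) - 1) =
      fps_X ^ 2 * catalan_gf ^ 4 * (fps_X ^ 2 * catalan_gf ^ 3)"
    by (simp only: add_0 power_Suc0_right)
  also have "\<dots> = fps_X ^ (2 + 2) * catalan_gf ^ (4 + 3)"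
    by (simp only: power_add mult_ac)
  finally have G: "fps_X ^ (0 + 2) * catalan_gf ^ 4 * (catalan_gf ^ Suc 0 * (1 - fps_X) - 1) =
      fps_X ^ 4 * catalan_gf ^ 7"
    by simp
  \<comment> \<open>This holds for \<open>n < 4\<close> too, where both sides are 0.\<close>
  have d: "real (d_seq n) = (fps_X ^ 4 * catalan_gf ^ 7) $ n" for n
    unfolding d_seq_eq_num_once num_once_gf G ..
  show "Abs_fps (\<lambda>n. if n \<ge> 4 then real (d_seq n) else 0) = fps_X ^ 4 * catalan_gf ^ 7"
    by (rule fps_ext) (simp add: d fps_X_power_mult_nth)
  show "fps_X ^ 4 * catalan_gf ^ 7 =
      Abs_fps (\<lambda>n. if n \<ge> 4 then 7 / (real n + 3) * real ((2 * n - 2) choose (n + 2)) else 0)"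
  proof (rule fps_ext)
    fix n
    show "(fps_X ^ 4 * catalan_gf ^ 7) $ n = Abs_fps (\<lambda>n. if n \<ge> 4
        then 7 / (real n + 3) * real ((2 * n - 2) choose (n + 2)) else 0) $ n"
    proof (cases "n \<ge> 4")
      case True
      \<comment> \<open>With \<open>n = m + 4\<close> the indices \<open>2 * n - 2\<close>,
        \<open>n + 2\<close> and \<open>n + 3\<close> become \<open>2 * m + 6\<close>,
        \<open>m + 6\<close> and \<open>m + 7\<close>.\<close>
      then obtain m where "n = m + 4" by (metis le_add_diff_inverse2)
      then show ?thesis by (simp add: fps_X_power_mult_nth catalan_gf_power_7_nth add.commute)
    qed (simp add: fps_X_power_mult_nth)
  qed
qed

end
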